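(* Let $P=\frac12P_1+\frac12P_2$, where $P_1$ and $P_2$ are the uniform probability distributions on $[0,1]$ and $[\frac12,\frac32]$, respectively. The optimal set of five-means for $P$ is $\{0.169821,\ 0.509464,\ \frac34,\ 0.990536,\ 1.33018\}$, with quantization error $V_5(P)=0.00721728$, where all decimal values are understood as rounded to the displayed digits (and $\frac34$ is exact).
   Context: For a Borel probability measure $P$ on $\mathbb{R}$ and a nonempty finite $\alpha\subset\mathbb{R}$, put $V(P;\alpha)=\int\min_{a\in\alpha}(x-a)^2\,dP(x)$. The $n$th quantization error is $V_n(P)=\inf\{V(P;\alpha):\alpha\subset\mathbb{R},\ 1\le\mathrm{card}(\alpha)\le n\}$, and an optimal set of $n$-means is a set $\alpha$ with $1\le\mathrm{card}(\alpha)\le n$ and $V(P;\alpha)=V_n(P)$. The measure $P$ here has density $\frac12$ on $[0,\frac12]\cup[1,\frac32]$, $1$ on $[\frac12,1]$, and $0$ elsewhere. *)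

theory Defs
  imports "HOL-Probability.Probability"
begin

text \<open>The integrand is nonnegative, so the distortion is an extended nonnegative real; this keeps
  the definition meaningful for measures without a second moment.\<close>

definition distortion :: "real measure \<Rightarrow> real set \<Rightarrow> ennreal" where
  "distortion P \<alpha> = (\<integral>\<^sup>+x. ennreal (MIN a\<in>\<alpha>. (x - a)\<^sup>2) \<partial>P)"

definition quantization_error :: "real measure \<Rightarrow> nat \<Rightarrow> ennreal" where
  "quantization_error P n = (INF \<alpha>\<in>{\<alpha>. 1 \<le> card \<alpha> \<and> card \<alpha> \<le> n}. distortion P \<alpha>)"

text \<open>As \<^term>\<open>card\<close> is \<open>0\<close> on infinite sets, \<open>1 \<le> card \<alpha>\<close> says that \<open>\<alpha>\<close> is finite and
  nonempty.\<close>

definition optimal_means :: "real measure \<Rightarrow> nat \<Rightarrow> real set \<Rightarrow> bool" where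
  "optimal_means P n \<alpha> \<longleftrightarrow>
     1 \<le> card \<alpha> \<and> card \<alpha> \<le> n \<and> distortion P \<alpha> = quantization_error P n"

definition half_mixture :: "'a measure \<Rightarrow> 'a measure \<Rightarrow> 'a measure" where
  "half_mixture M N =
     measure_of (space M) (sets M) (\<lambda>A. (1/2) * emeasure M A + (1/2) * emeasure N A)"

definition P1 :: "real measure" where
  "P1 = uniform_measure lborel {0..1}"

definition P2 :: "real measure" where
  "P2 = uniform_measure lborel {1/2..3/2}"

definition mixP :: "real measure" where
  "mixP = half_mixture P1 P2"

definition round_dec :: "nat \<Rightarrow> real \<Rightarrow> real" where
  "round_dec d x = of_int (round (x * 10 ^ d)) / 10 ^ d"

lemma space_half_mixture [simp]: "space (half_mixture M N) = space M"
  unfolding half_mixture_def by (rule space_measure_of) (rule sets.space_closed)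

lemma sets_half_mixture [simp, measurable_cong]: "sets (half_mixture M N) = sets M"
  unfolding half_mixture_def by simp

text \<open>\<^const>\<open>measure_of\<close> returns the given set function only if it is a measure.\<close>

lemma emeasure_half_mixture:
  assumes eq: "sets N = sets M" and A: "A \<in> sets M"
  shows "emeasure (half_mixture M N) A = (1/2) * emeasure M A + (1/2) * emeasure N A"
proof (rule emeasure_measure_of[OF half_mixture_def])
  show "sets M \<subseteq> Pow (space M)" by (rule sets.space_closed)
  show "A \<in> sets (half_mixture M N)" using A by simp
  show "positive (sets (half_mixture M N)) (\<lambda>A. (1/2) * emeasure M A + (1/2) * emeasure N A)"
    by (simp add: positive_def)
  show "countably_additive (sets (half_mixture M N))
          (\<lambda>A. (1/2) * emeasure M A + (1/2) * emeasure N A)"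
  proof (rule countably_additiveI)
    fix F :: "nat \<Rightarrow> 'a set"
    assume F: "range F \<subseteq> sets (half_mixture M N)" "disjoint_family F"
    have "(\<Sum>i. emeasure M (F i)) = emeasure M (\<Union>(range F))"
      using F by (intro suminf_emeasure) auto
    moreover have "(\<Sum>i. emeasure N (F i)) = emeasure N (\<Union>(range F))"
      using F eq by (intro suminf_emeasure) auto
    moreover have "(\<Sum>i. (1/2) * emeasure M (F i) + (1/2) * emeasure N (F i)) =
        (\<Sum>i. (1/2) * emeasure M (F i)) + (\<Sum>i. (1/2) * emeasure N (F i))"
      by (rule suminf_add[symmetric]) auto
    ultimately show "(\<Sum>i. (1/2) * emeasure M (F i) + (1/2) * emeasure N (F i)) =
        (1/2) * emeasure M (\<Union>(range F)) + (1/2) * emeasure N (\<Union>(range F))"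
      by (simp add: ennreal_suminf_cmult)
  qed
qed

lemma sets_mixP [simp, measurable_cong]: "sets mixP = sets borel"
  by (simp add: mixP_def P1_def)

lemma emeasure_mixP:
  assumes "A \<in> sets borel"
  shows "emeasure mixP A = (1/2) * emeasure P1 A + (1/2) * emeasure P2 A"
  unfolding mixP_def using assms by (intro emeasure_half_mixture) (simp_all add: P1_def P2_def)

lemma ennreal_half: "ennreal (1/2) = 1/2"
  using ennreal_divide_numeral[of 1 "num.Bit0 num.One"] by simp

lemma ennreal_half_add_half: "(1/2 :: ennreal) + 1/2 = 1"
proof -
  have "ennreal (1/2) + ennreal (1/2) = ennreal 1"
    by (subst ennreal_plus[symmetric]) auto
  then show ?thesis by (simp only: ennreal_half ennreal_1)
qed

text \<open>The two densities are added, so at the single points \<open>1/2\<close> and \<open>1\<close> the value is \<open>1\<close>.\<close>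

lemma mixP_eq_density:
  "mixP = density lborel (\<lambda>x. ennreal (if 1/2 \<le> x \<and> x \<le> 1 then 1
          else if 0 \<le> x \<and> x \<le> 3/2 then 1/2 else 0))" (is "mixP = density lborel ?f")
proof (rule measure_eqI)
  fix A assume "A \<in> sets mixP"
  then have A [measurable]: "A \<in> sets borel" by simp
  have f: "?f x = (1/2) * indicator {0..1} x + (1/2) * indicator {1/2..3/2} x" for x :: real
    using ennreal_half ennreal_half_add_half by (auto simp: indicator_def)
  have "emeasure (density lborel ?f) A =
      (\<integral>\<^sup>+x. (1/2) * indicator ({0..1} \<inter> A) x + (1/2) * indicator ({1/2..3/2} \<inter> A) x \<partial>lborel)"
    unfolding f by (subst emeasure_density) (auto simp: indicator_def intro!: nn_integral_cong)
  also have "\<dots> = (1/2) * emeasure lborel ({0..1} \<inter> A) + (1/2) * emeasure lborel ({1/2..3/2} \<inter> A)"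
    by (subst nn_integral_add) (auto simp: nn_integral_cmult)
  also have "\<dots> = emeasure mixP A"
    by (simp add: emeasure_mixP P1_def P2_def divide_ennreal_def)
  finally show "emeasure mixP A = emeasure (density lborel ?f) A" by simp
qed simp

lemma prob_space_mixP: "prob_space mixP"
proof
  have sp: "space mixP = UNIV" using sets_eq_imp_space_eq[OF sets_mixP] by simp
  have "emeasure P1 UNIV = 1" "emeasure P2 UNIV = 1"
    by (simp_all add: P1_def P2_def)
  then show "emeasure mixP (space mixP) = 1"
    by (simp add: sp emeasure_mixP ennreal_half_add_half del: ennreal_plus)
qed

end

theory Submission
  imports Defs
begin

text \<open>Write \<open>c1 \<le> c2 \<le> c3 \<le> c4 \<le> c5\<close> for the points of a candidate set, repeated if there are fewer
  than five. The third point \<open>c3\<close> cuts the problem in two: left of \<open>c3\<close> only \<open>c1, c2, c3\<close> matter,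
  right of it only \<open>c3, c4, c5\<close>, and the reflection \<open>x \<mapsto> 3/2 - x\<close>, which preserves \<open>P\<close>, turns the
  right side into a left side whose last point is \<open>3/2 - c3\<close>.

  Let \<open>L(c)\<close> be the least cost on \<open>[0, c]\<close> of three points of which the last is \<open>c\<close>. The density
  jumps at \<open>1/2\<close>, so it is not log-concave and the classical uniqueness theorem does not apply.
  What saves the argument is that the graph of \<open>L\<close> on \<open>[1/2, 1]\<close> lies above its tangent at \<open>3/4\<close>,
  touching it only there:
  \<open>L(c) \<ge> L(3/4) + L'(3/4) (c - 3/4)\<close>. Adding the inequalities for \<open>c3\<close> and \<open>3/2 - c3\<close>, the linear
  terms cancel and the total cost is at least \<open>2 L(3/4)\<close>, with equality for one configuration only.
  If \<open>c3 > 1\<close>, the left side alone already costs at least \<open>L(1)\<close>, which by the tangent bound exceeds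
  \<open>2 L(3/4)\<close>; the case \<open>c3 < 1/2\<close> is its mirror image.

  The slope \<open>L'(3/4)\<close> is the squared half-gap \<open>h\<^sup>2\<close> between the second and the third optimal point: moving
  \<open>c\<close> changes only the cell of \<open>c\<close>, and \<open>h\<close> is the distance from \<open>c\<close> to the border of that cell. In
  terms of \<open>a, b, c\<close> the tangent bound (lemma \<open>left_cost_bound\<close>) is an inequality between piecewise
  cubic polynomials; which piece applies depends on the cell containing the jump \<open>1/2\<close>. If it lies
  in the cell of \<open>b\<close>, as it does at the optimum, the difference of the two sides is a sum of three
  terms, one measuring how far \<open>a\<close> is from \<open>b/3\<close>, one how far \<open>b\<close> is from its optimal value and one
  how far \<open>c - b\<close> is from \<open>2 h\<close> (lemmas \<open>two_cells_identity\<close> and \<open>separable_identity\<close>). For \<open>b\<close> up to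
  about \<open>1/3\<close>, and if the jump lies in another cell, the inequality is strict and cruder estimates
  suffice.\<close>

section \<open>The squared distance to a finite set\<close>

definition sqdist :: "real set \<Rightarrow> real \<Rightarrow> real" where
  "sqdist \<alpha> x = (MIN a\<in>\<alpha>. (x - a)\<^sup>2)"

lemma sqdist_insert:
  "finite \<alpha> \<Longrightarrow> \<alpha> \<noteq> {} \<Longrightarrow> sqdist (insert a \<alpha>) x = min ((x - a)\<^sup>2) (sqdist \<alpha> x)"
  by (simp add: sqdist_def)

lemma sqdist_singleton: "sqdist {a} x = (x - a)\<^sup>2"
  by (simp add: sqdist_def)

lemmas sqdist_simps = sqdist_insert sqdist_singleton

lemma continuous_on_sqdist:
  assumes "finite \<alpha>" "\<alpha> \<noteq> {}"
  shows "continuous_on S (sqdist \<alpha>)"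
  using assms
proof (induction \<alpha> rule: finite_ne_induct)
  case (singleton a)
  have "sqdist {a} = (\<lambda>x. (x - a)\<^sup>2)" by (auto simp: sqdist_simps)
  then show ?case by (simp add: continuous_intros)
next
  case (insert a \<alpha>)
  then have "sqdist (insert a \<alpha>) = (\<lambda>x. min ((x - a)\<^sup>2) (sqdist \<alpha> x))"
    by (simp add: sqdist_insert fun_eq_iff)
  with insert show ?case by (auto intro!: continuous_intros)
qed

lemma integrable_sqdist:
  "finite \<alpha> \<Longrightarrow> \<alpha> \<noteq> {} \<Longrightarrow> sqdist \<alpha> integrable_on {p..q}"
  by (intro integrable_continuous_interval continuous_on_sqdist)

lemma sqdist_nonneg: "finite \<alpha> \<Longrightarrow> \<alpha> \<noteq> {} \<Longrightarrow> 0 \<le> sqdist \<alpha> x"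
  by (auto simp: sqdist_def)

text \<open>Every comparison below, whether dropping points that are never nearest or clipping points to an
  interval, replaces each point by one that is at least as near to \<open>x\<close>.\<close>

lemma sqdist_dominated:
  assumes "finite \<alpha>" "\<alpha> \<noteq> {}" "finite \<beta>"
    and "\<And>a. a \<in> \<alpha> \<Longrightarrow> \<exists>b\<in>\<beta>. (x - b)\<^sup>2 \<le> (x - a)\<^sup>2"
  shows "sqdist \<beta> x \<le> sqdist \<alpha> x"
proof -
  have "sqdist \<beta> x \<le> (x - a)\<^sup>2" if a: "a \<in> \<alpha>" for a
  proof -
    obtain b where "b \<in> \<beta>" "(x - b)\<^sup>2 \<le> (x - a)\<^sup>2" using assms(4)[OF a] by blast
    then show ?thesis
      using assms(3) unfolding sqdist_def by (intro order_trans[OF Min_le]) auto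
  qed
  then show ?thesis
    using assms(1,2) by (simp add: sqdist_def[of \<alpha>])
qed

lemma sqdist_reflect: "sqdist ((\<lambda>a. s - a) ` \<alpha>) (s - x) = sqdist \<alpha> x"
  by (simp add: sqdist_def image_image power2_commute)

lemma has_integral_reflect:
  fixes f :: "real \<Rightarrow> real"
  assumes "(f has_integral i) {s - q..s - p}"
  shows "((\<lambda>x. f (s - x)) has_integral i) {p..q}"
proof -
  have image: "(\<lambda>x. s - x) ` {s - q..s - p} = {p..q}" by simp
  show ?thesis
    using has_integral_affinity[of f i "s - q" "s - p" "-1" s] assms image by simp
qed

lemma integral_reflect:
  "integral {p..q} (\<lambda>x. f (s - x)) = integral {s - q..s - p} f" for f :: "real \<Rightarrow> real"
proof -
  have "((\<lambda>x. f (s - x)) has_integral i) {p..q} \<longleftrightarrow> (f has_integral i) {s - q..s - p}" for i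
    using has_integral_reflect[of f i s q p]
      has_integral_reflect[of "\<lambda>x. f (s - x)" i s "s - p" "s - q"] by auto
  then show ?thesis by (simp add: integral_def integrable_on_def)
qed

lemma nearer_left:
  fixes a b x :: real
  assumes "a \<le> b" "2 * x \<le> a + b"
  shows "(x - a)\<^sup>2 \<le> (x - b)\<^sup>2"
proof -
  have "(x - b)\<^sup>2 - (x - a)\<^sup>2 = (b - a) * (a + b - 2 * x)"
    by (simp add: power2_eq_square algebra_simps)
  moreover have "0 \<le> (b - a) * (a + b - 2 * x)"
    using assms by simp
  ultimately show ?thesis by linarith
qed

lemma nearer_right: "a \<le> b \<Longrightarrow> a + b \<le> 2 * x \<Longrightarrow> (x - b)\<^sup>2 \<le> (x - a)\<^sup>2" for a b x :: real
  using nearer_left[of "-b" "-a" "-x"] by (simp add: power2_commute)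

lemma has_integral_square:
  fixes f :: "real \<Rightarrow> real"
  assumes "p \<le> q" "\<And>x. p \<le> x \<Longrightarrow> x \<le> q \<Longrightarrow> f x = (x - a)\<^sup>2"
  shows "(f has_integral (q - a)^3 / 3 - (p - a)^3 / 3) {p..q}"
proof -
  have "((\<lambda>x. (x - a)\<^sup>2) has_integral (q - a)^3 / 3 - (p - a)^3 / 3) {p..q}"
    using assms(1)
    by (intro fundamental_theorem_of_calculus)
       (auto intro!: derivative_eq_intros simp flip: has_real_derivative_iff_has_vector_derivative)
  then show ?thesis
    by (rule has_integral_eq[rotated]) (use assms in auto)
qed

lemma sqdist_three_cells:
  assumes "a \<le> b" "b \<le> c"
  shows "2 * x \<le> a + b \<Longrightarrow> sqdist {a, b, c} x = (x - a)\<^sup>2"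
    and "a + b \<le> 2 * x \<Longrightarrow> 2 * x \<le> b + c \<Longrightarrow> sqdist {a, b, c} x = (x - b)\<^sup>2"
    and "b + c \<le> 2 * x \<Longrightarrow> sqdist {a, b, c} x = (x - c)\<^sup>2"
proof -
  show "sqdist {a, b, c} x = (x - a)\<^sup>2" if "2 * x \<le> a + b"
    using nearer_left[of a b x] nearer_left[of a c x] that assms by (simp add: sqdist_simps)
  show "sqdist {a, b, c} x = (x - b)\<^sup>2" if "a + b \<le> 2 * x" "2 * x \<le> b + c"
    using nearer_right[of a b x] nearer_left[of b c x] that assms by (simp add: sqdist_simps)
  show "sqdist {a, b, c} x = (x - c)\<^sup>2" if "b + c \<le> 2 * x"
    using nearer_right[of b c x] nearer_right[of a c x] that assms by (simp add: sqdist_simps)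
qed

text \<open>The integral starts at a point \<open>p\<close> in the cell of \<open>b\<close>, on either side of \<open>b\<close>; the two half-cells
  between \<open>b\<close> and \<open>c\<close> contribute \<open>(c - b)\<^sup>3 / 12\<close>.\<close>

lemma has_integral_last_two_cells:
  assumes "a \<le> b" "b \<le> c" "a + b \<le> 2 * p" "2 * p \<le> b + c"
  shows "(sqdist {a, b, c} has_integral (c - b)^3 / 12 - (p - b)^3 / 3) {p..c}"
proof -
  have "(sqdist {a, b, c} has_integral ((b + c) / 2 - b)^3 / 3 - (p - b)^3 / 3) {p..(b + c) / 2}"
    using assms by (intro has_integral_square sqdist_three_cells) auto
  moreover have "(sqdist {a, b, c} has_integral (c - c)^3 / 3 - ((b + c) / 2 - c)^3 / 3) {(b + c) / 2..c}"
    using assms by (intro has_integral_square sqdist_three_cells) auto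
  ultimately have "(sqdist {a, b, c} has_integral
      ((b + c) / 2 - b)^3 / 3 - (p - b)^3 / 3 + ((c - c)^3 / 3 - ((b + c) / 2 - c)^3 / 3)) {p..c}"
    using assms by (intro has_integral_combine[of p "(b + c) / 2"]) auto
  then show ?thesis by (rule has_integral_eq_rhs) (simp add: power3_eq_cube field_simps)
qed

lemma integral_three_cells:
  assumes "0 \<le> a" "a \<le> b" "b \<le> c"
  shows "integral {0..c} (sqdist {a, b, c}) = a^3 / 3 + (b - a)^3 / 12 + (c - b)^3 / 12"
proof -
  have "(sqdist {a, b, c} has_integral ((a + b) / 2 - a)^3 / 3 - (0 - a)^3 / 3) {0..(a + b) / 2}"
    using assms by (intro has_integral_square sqdist_three_cells) auto
  moreover have "(sqdist {a, b, c} has_integral (c - b)^3 / 12 - ((a + b) / 2 - b)^3 / 3) {(a + b) / 2..c}"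
    using assms by (intro has_integral_last_two_cells) auto
  ultimately have "(sqdist {a, b, c} has_integral
      ((a + b) / 2 - a)^3 / 3 - (0 - a)^3 / 3 + ((c - b)^3 / 12 - ((a + b) / 2 - b)^3 / 3)) {0..c}"
    using assms by (intro has_integral_combine[of 0 "(a + b) / 2"]) auto
  then show ?thesis
    by (intro integral_unique, elim has_integral_eq_rhs) (simp add: power3_eq_cube field_simps)
qed

section \<open>The optimal configuration\<close>

text \<open>The constants come from the stationarity conditions, assuming that the third point is \<open>3/4\<close> and that
  \<open>1/2\<close> lies in the cell of the second point \<open>b\<close>. The first point then has to be \<open>b/3\<close>, and the derivative
  with respect to \<open>b\<close> vanishes iff \<open>b\<^sup>2/18 + (b - 1/2)\<^sup>2/2 = (3/4 - b)\<^sup>2/4\<close>, that is,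
  \<open>11 b\<^sup>2 - 9/2 b - 9/16 = 0\<close>. Its positive root is \<open>second\<close>, and \<open>gap\<close> is half the distance from there to
  \<open>3/4\<close>. The cost of one side is \<open>half_error\<close>, and \<open>gap\<^sup>2\<close> is the slope of the tangent.\<close>

definition gap :: real where "gap = (12 - 3 * sqrt 5) / 44"
definition second :: real where "second = (9 + 6 * sqrt 5) / 44"
definition half_error :: real where "half_error = 109/11616 - 5/1936 * sqrt 5"

lemma sqrt5_bounds: "22360679774 / 10000000000 < sqrt 5" "sqrt 5 < 22360679775 / 10000000000"
  by (rule real_less_rsqrt real_less_lsqrt; simp add: power2_eq_square)+

lemma gap_sq: "gap\<^sup>2 = 189/1936 - 9/242 * sqrt 5"
  by (simp add: gap_def power2_eq_square field_simps)

lemma second_eq: "second = 3/4 - 2 * gap"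
  by (simp add: gap_def second_def field_simps)

lemma second_stationary: "second\<^sup>2 / 18 + (second - 1/2)\<^sup>2 / 2 = gap\<^sup>2"
  by (simp add: gap_def second_def power2_eq_square field_simps)

lemma half_error_eq: "half_error = second^3 / 54 + (second - 1/2)^3 / 6 + 2/3 * gap^3"
proof -
  have "((9 + 6 * s) / 44)^3 / 54 + ((9 + 6 * s) / 44 - 1/2)^3 / 6 + 2/3 * ((12 - 3 * s) / 44)^3
      = (2398/3 - 330 * s + 22 * s^3) / 85184" for s :: real
    by (simp add: power3_eq_cube field_simps)
  moreover have "(sqrt 5)^3 = 5 * sqrt 5" by (simp add: power3_eq_cube)
  ultimately show ?thesis unfolding half_error_def gap_def second_def
    by (simp only:) (simp add: diff_divide_distrib)
qed

text \<open>The last bound says that the tangent is positive only to the right of a point just above \<open>1/2\<close>, or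
  equivalently that at \<open>c = 1\<close> it exceeds \<open>2 * half_error\<close>; the relative margin is about one part in
  five hundred.\<close>

lemma numeric_bounds:
  shows "1202/10000 < gap" "gap < 1203/10000" "50946/100000 < second" "second < 50947/100000"
    and "gap\<^sup>2 < 14465/1000000"
    and "half_error - 3/4 * gap\<^sup>2 < - 7239/1000000" "half_error < gap\<^sup>2 / 4"
  using sqrt5_bounds unfolding gap_sq
  unfolding gap_def second_def half_error_def
  by (simp_all add: diff_divide_distrib)

section \<open>The tangent bound as a polynomial inequality\<close>

text \<open>On \<open>[0, b]\<close> with points \<open>a\<close> and \<open>b\<close> the best choice is \<open>a = b/3\<close>: three half-cells of equal length.
  The remainder is nonnegative for \<open>0 \<le> a \<le> b\<close>.\<close>

lemma two_cells_identity:
  "a^3 / 3 + (b - a)^3 / 12 = b^3 / 27 + (a - b/3)\<^sup>2 * (5 * b / 12 + a / 4)" for a b :: real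
  by (simp add: power2_eq_square power3_eq_cube field_simps)

lemma two_cells_bound:
  fixes a b :: real
  assumes "0 \<le> a" "a \<le> b"
  shows "b^3 / 27 \<le> a^3 / 3 + (b - a)^3 / 12"
  using assms unfolding two_cells_identity by simp

text \<open>Likewise \<open>[0, c]\<close> is best divided into five half-cells of length \<open>c/5\<close>, which puts \<open>b\<close> at \<open>3c/5\<close>.\<close>

lemma three_cells_identity:
  "b^3 / 27 + (c - b)^3 / 12 = c^3 / 75 + (b - 3 * c / 5)\<^sup>2 * ((21 * c - 5 * b) / 108)"
  for b c :: real
  by (simp add: power2_eq_square power3_eq_cube field_simps)

text \<open>The right-hand side is the cost if \<open>1/2\<close> lies in the cell of \<open>c\<close>. The jump then affects neither \<open>a\<close>
  nor \<open>b\<close>, so five equal half-cells are best for given \<open>c\<close>, and a strict inequality for a cubic in \<open>c\<close> remains.\<close>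

lemma tangent_bound_edge_in_third_cell:
  fixes a b c :: real
  assumes "0 \<le> a" "a \<le> b" "b \<le> c" "1/2 \<le> c" "c \<le> 1"
  shows "half_error + gap\<^sup>2 * (c - 3/4)
    < (a^3 / 3 + (b - a)^3 / 12 + (c - b)^3 / 12) / 2 + (c - 1/2)^3 / 6"
proof -
  have "c^3 / 75 \<le> b^3 / 27 + (c - b)^3 / 12"
    using assms unfolding three_cells_identity by simp
  then have equal_cells: "c^3 / 75 \<le> a^3 / 3 + (b - a)^3 / 12 + (c - b)^3 / 12"
    using two_cells_bound[of a b] assms by linarith
  \<comment> \<open>Convexity: the cubic lies above its tangent at \<open>617/1000\<close>, near the minimum of its difference to
    the linear bound; \<open>Q\<close> is the remainder of the Taylor expansion there.\<close>
  define Q where "Q = (c - 617/1000)\<^sup>2 * (13/75 * (c - 617/1000) + 7084/100000)"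
  have "0 \<le> Q"
    using assms unfolding Q_def
    by (intro mult_nonneg_nonneg) (rule zero_le_power2, simp add: field_simps)
  moreover have "c^3 / 150 + (c - 1/2)^3 / 6 = Q + ((617/1000)^3 / 150 + (117/1000)^3 / 6)
      + ((617/1000)\<^sup>2 / 50 + (117/1000)\<^sup>2 / 2) * (c - 617/1000)"
    by (simp add: Q_def power2_eq_square power3_eq_cube field_simps)
  ultimately have "14465/1000000 * c - 7239/1000000 < c^3 / 150 + (c - 1/2)^3 / 6"
    using assms by (simp add: power2_eq_square power3_eq_cube[of "_ / _"] diff_divide_distrib)
  moreover have "gap\<^sup>2 * c \<le> 14465/1000000 * c"
    using assms numeric_bounds by (intro mult_right_mono) auto
  ultimately show ?thesis
    using equal_cells numeric_bounds by (simp add: algebra_simps add_divide_distrib)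
qed

text \<open>For \<open>a = b/3\<close> and \<open>1/2\<close> in the cell of \<open>b\<close>, the excess over the tangent separates into a function of \<open>b\<close>
  and a function of \<open>w = c - b\<close>, since \<open>gap\<^sup>2 * c = gap\<^sup>2 * b + gap\<^sup>2 * w\<close>. Both are cubics with a critical point at
  the optimal value, so each has a double root there after subtracting its value. The third root of
  the cubic in \<open>b\<close> is \<open>27/20 - 2 * second\<close>, about \<open>0.331\<close>.\<close>

lemma separable_identity:
  "b^3 / 54 + (b - 1/2)^3 / 6 + (c - b)^3 / 12 - gap\<^sup>2 * c = half_error - 3/4 * gap\<^sup>2
   + 5/27 * (b - second)\<^sup>2 * (b - (27/20 - 2 * second))
   + (c - b - 2 * gap)\<^sup>2 * (c - b + 4 * gap) / 12"
proof -
  have "b^3 / 54 + (b - 1/2)^3 / 6 - (second\<^sup>2 / 18 + (second - 1/2)\<^sup>2 / 2) * b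
     = second^3 / 54 + (second - 1/2)^3 / 6 - (second\<^sup>2 / 18 + (second - 1/2)\<^sup>2 / 2) * second
      + 5/27 * (b - second)\<^sup>2 * (b - (27/20 - 2 * second))"
    by (simp add: power2_eq_square power3_eq_cube field_simps)
  moreover have "(c - b)^3 / 12 - gap\<^sup>2 * (c - b) + 4/3 * gap^3 =
       (c - b - 2 * gap)\<^sup>2 * (c - b + 4 * gap) / 12"
    by (simp add: power2_eq_square power3_eq_cube field_simps)
  moreover have "half_error - 3/4 * gap\<^sup>2 = second^3 / 54 + (second - 1/2)^3 / 6 - gap\<^sup>2 * second - 4/3 * gap^3"
    by (simp add: half_error_eq second_eq power2_eq_square power3_eq_cube field_simps)
  moreover have "gap\<^sup>2 * c = gap\<^sup>2 * b + gap\<^sup>2 * (c - b)"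
    by (simp add: algebra_simps)
  ultimately show ?thesis unfolding second_stationary by linarith
qed

text \<open>The three excess terms are nonnegative once \<open>b\<close> is beyond the third root in \<open>separable_identity\<close>. For
  \<open>b \<le> 1/3\<close> the constraint \<open>1 \<le> b + c\<close> forces \<open>c - b\<close> to be so far above \<open>2 * gap\<close> that the inequality is
  strict.\<close>

lemma tangent_bound_edge_in_second_cell:
  fixes a b c :: real
  assumes "0 \<le> a" "a \<le> b" "b \<le> c" "1 \<le> b + c"
  defines "D \<equiv> (a^3 / 3 + (b - a)^3 / 12 + (c - b)^3 / 12) / 2 + ((c - b)^3 / 12 + (b - 1/2)^3 / 3) / 2"
  shows "half_error + gap\<^sup>2 * (c - 3/4) \<le> D"
    and "D = half_error + gap\<^sup>2 * (c - 3/4) \<Longrightarrow> a = second / 3 \<and> b = second \<and> c = 3/4"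
proof -
  define R where "R = half_error + gap\<^sup>2 * (c - 3/4)"
  define A where "A = (a - b/3)\<^sup>2 * (5 * b / 12 + a / 4) / 2"
  define B where "B = 5/27 * (b - second)\<^sup>2 * (b - (27/20 - 2 * second))"
  define C where "C = (c - b - 2 * gap)\<^sup>2 * (c - b + 4 * gap) / 12"
  have A: "0 \<le> A" using assms by (simp add: A_def)
  have C: "0 \<le> C" using assms numeric_bounds by (simp add: C_def)
  have sep: "b^3 / 54 + (b - 1/2)^3 / 6 + (c - b)^3 / 12 - gap\<^sup>2 * c
      = half_error - 3/4 * gap\<^sup>2 + B + C"
    unfolding B_def C_def by (rule separable_identity)
  have "a^3 / 3 + (b - a)^3 / 12 = b^3 / 27 + 2 * A"
    unfolding A_def two_cells_identity by simp
  then have D: "D = R + A + B + C"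
    using sep unfolding D_def R_def right_diff_distrib add_divide_distrib by simp
  have "R \<le> D \<and> (D = R \<longrightarrow> a = second / 3 \<and> b = second \<and> c = 3/4)"
  proof (cases "b \<le> 1/3")
    case True
    \<comment> \<open>\<open>W\<close> is the least value that \<open>w\<close> can take; the cubic in \<open>w\<close> is increasing from there on.\<close>
    define w W where "w = c - b" and "W = 1 - 2 * b"
    have W: "1/3 \<le> W" "W \<le> w" using True assms by (auto simp: w_def W_def)
    have "0 \<le> (w - W)\<^sup>2 * (w + 2 * W) / 12" using W by simp
    moreover have "0 \<le> (w - W) * (W\<^sup>2 / 4 - gap\<^sup>2)"
    proof -
      have "(1/3)\<^sup>2 \<le> W\<^sup>2" using W by (intro power_mono) auto
      then show ?thesis using W numeric_bounds by (simp add: power2_eq_square)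
    qed
    moreover have "w^3 / 12 - gap\<^sup>2 * w = W^3 / 12 - gap\<^sup>2 * W + (w - W) * (W\<^sup>2 / 4 - gap\<^sup>2)
        + (w - W)\<^sup>2 * (w + 2 * W) / 12"
      by (simp add: power2_eq_square power3_eq_cube field_simps)
    ultimately have outer: "W^3 / 12 - gap\<^sup>2 * W \<le> w^3 / 12 - gap\<^sup>2 * w" by linarith
    \<comment> \<open>In powers of \<open>y\<close> the cubic in \<open>b\<close> has nonnegative coefficients, so on \<open>b \<le> 1/3\<close> it is least
    at \<open>1/3\<close>.\<close>
    define y where "y = 1/3 - b"
    have y: "0 \<le> y" "b = 1/3 - y" using True by (auto simp: y_def)
    define Y where "Y = y * y * (1/54 + 1/4) + y * y * y * (1/2 - 1/54)"
    have "0 \<le> Y" using y by (simp add: Y_def)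
    moreover have "b^3 / 54 + (b - 1/2)^3 / 6 + W^3 / 12
        = (1/3)^3 / 54 + (1/6)^3 / 2 + y * (1/24 - 1/162)
          + Y"
      unfolding W_def Y_def y(2) by (simp add: power3_eq_cube field_simps)
    moreover have "gap\<^sup>2 * (b + W) \<le> 14465/1000000 * (2/3 + y)"
      using numeric_bounds y(1) unfolding W_def y(2) by (intro mult_mono) auto
    ultimately have "- 7239/1000000 < b^3 / 54 + (b - 1/2)^3 / 6 + W^3 / 12 - gap\<^sup>2 * (b + W)"
      using y(1) by (simp add: power3_eq_cube[of "_ / _"] diff_divide_distrib add_divide_distrib)
    moreover have "gap\<^sup>2 * c = gap\<^sup>2 * b + gap\<^sup>2 * w" by (simp add: w_def algebra_simps)
    ultimately have "R < D"
      using outer sep A D numeric_bounds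
      unfolding R_def w_def[symmetric] right_diff_distrib distrib_left by linarith
    then show ?thesis by simp
  next
    case False
    then have pos: "0 < b - (27/20 - 2 * second)" using numeric_bounds by simp
    then have B: "0 \<le> B" by (simp add: B_def)
    show ?thesis
    proof (intro conjI impI)
      show "R \<le> D" using A B C D by simp
      assume "D = R"
      then have "A = 0" "B = 0" "C = 0" using A B C D by auto
      have "b = second" using \<open>B = 0\<close> pos by (simp add: B_def)
      moreover have "c = b + 2 * gap" using \<open>C = 0\<close> assms numeric_bounds by (simp add: C_def)
      moreover have "a = b / 3" using \<open>A = 0\<close> assms False by (simp add: A_def)
      ultimately show "a = second / 3" "b = second" "c = 3/4" by (simp_all add: second_eq)
    qed
  qed
  then show "half_error + gap\<^sup>2 * (c - 3/4) \<le> D"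
    "D = half_error + gap\<^sup>2 * (c - 3/4) \<Longrightarrow> a = second / 3 \<and> b = second \<and> c = 3/4"
    by (auto simp: R_def)
qed

text \<open>If \<open>1/2\<close> lies in the cell of \<open>a\<close>, then \<open>b \<ge> 1/2\<close>, and it suffices to count the doubled density on
  \<open>[b, c]\<close> only, which gives the last summand.\<close>

lemma tangent_bound_edge_in_first_cell:
  fixes a b c :: real
  assumes "0 \<le> a" "a \<le> b" "b \<le> c" "1 \<le> a + b"
  shows "half_error + gap\<^sup>2 * (c - 3/4)
    < (a^3 / 3 + (b - a)^3 / 12 + (c - b)^3 / 12) / 2 + (c - b)^3 / 24"
proof -
  define w where "w = c - b"
  have "0 \<le> (w - 2 * gap)\<^sup>2 * (w + 4 * gap) / 12"
    using assms numeric_bounds by (simp add: w_def)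
  moreover have "w^3 / 12 - gap\<^sup>2 * w + 4/3 * gap^3 = (w - 2 * gap)\<^sup>2 * (w + 4 * gap) / 12"
    by (simp add: power2_eq_square power3_eq_cube field_simps)
  moreover have "gap^3 \<le> (1203/10000)^3" using numeric_bounds by (intro power_mono) auto
  ultimately have outer: "- 2322/1000000 \<le> w^3 / 12 - gap\<^sup>2 * w" by (simp add: power3_eq_cube)
  \<comment> \<open>A tangent makes the bound on \<open>b\<close> linear; the contact point \<open>7/10\<close> is close enough to the worst
    \<open>b\<close> on either side of \<open>5/8\<close>.\<close>
  have "0 \<le> (b - 7/10)\<^sup>2 * (b + 14/10)" using assms by simp
  then have cube: "343/1000 + 147/100 * (b - 7/10) \<le> b^3"
    by (simp add: power2_eq_square power3_eq_cube field_simps)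
  have h: "gap\<^sup>2 * b \<le> 14465/1000000 * b" using assms numeric_bounds by (intro mult_right_mono) auto
  have "14465/1000000 * b - 4917/1000000 < (a^3 / 3 + (b - a)^3 / 12) / 2"
  proof (cases "b \<le> 5/8")
    case True
    \<comment> \<open>From \<open>a \<ge> 1 - b\<close> and \<open>b \<le> 5/8\<close> the point \<open>a\<close> is at least \<open>1/6\<close> above its best position \<open>b/3\<close>.\<close>
    have "(1/6)\<^sup>2 * (5/24) \<le> (a - b/3)\<^sup>2 * (5 * b / 12 + a / 4)"
      using True assms by (intro mult_mono power_mono) auto
    then show ?thesis using two_cells_identity[of a b] cube assms
      by (simp add: power2_eq_square[of "1/6"] add_divide_distrib diff_divide_distrib)
  next
    case False
    then show ?thesis using two_cells_bound[of a b] cube assms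
      by (simp add: add_divide_distrib diff_divide_distrib)
  qed
  moreover have "gap\<^sup>2 * c = gap\<^sup>2 * b + gap\<^sup>2 * w" by (simp add: w_def algebra_simps)
  ultimately show ?thesis
    using outer h numeric_bounds
    unfolding w_def[symmetric] right_diff_distrib add_divide_distrib by linarith
qed

section \<open>The cost of one side\<close>

text \<open>The density is \<open>1/2\<close> on \<open>[0, 3/2]\<close> plus \<open>1/2\<close> on \<open>[1/2, 1]\<close>, so for \<open>1/2 \<le> c \<le> 1\<close> this is the distortion
  of \<open>{a, b, c}\<close> over \<open>[0, c]\<close>.\<close>

definition left_cost :: "real \<Rightarrow> real \<Rightarrow> real \<Rightarrow> real" where
  "left_cost a b c = (integral {0..c} (sqdist {a, b, c}) + integral {1/2..c} (sqdist {a, b, c})) / 2"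

lemma left_cost_edge_in_second_cell:
  assumes "0 \<le> a" "a \<le> b" "b \<le> c" "a + b \<le> 1" "1 \<le> b + c"
  shows "left_cost a b c = (a^3 / 3 + (b - a)^3 / 12 + (c - b)^3 / 12) / 2
    + ((c - b)^3 / 12 + (b - 1/2)^3 / 3) / 2"
proof -
  have "integral {1/2..c} (sqdist {a, b, c}) = (c - b)^3 / 12 - (1/2 - b)^3 / 3"
    using assms by (intro integral_unique has_integral_last_two_cells) auto
  moreover have "(b - 1/2)^3 = - ((1/2 - b)^3)" by (simp add: power3_eq_cube algebra_simps)
  ultimately show ?thesis
    using assms unfolding left_cost_def
    by (simp add: integral_three_cells add_divide_distrib diff_divide_distrib)
qed

lemma left_cost_optimum: "left_cost (second / 3) second (3/4) = half_error"
proof -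
  have "left_cost (second / 3) second (3/4) = second^3 / 54 + (second - 1/2)^3 / 6 + (3/4 - second)^3 / 12"
    using numeric_bounds by (subst left_cost_edge_in_second_cell) (auto simp: power3_eq_cube field_simps)
  also have "3/4 - second = 2 * gap" by (simp add: second_eq)
  finally show ?thesis by (simp add: half_error_eq power_mult_distrib)
qed

lemma left_cost_bound_nonneg:
  assumes "0 \<le> a" "a \<le> b" "b \<le> c" "1/2 \<le> c" "c \<le> 1"
  shows "half_error + gap\<^sup>2 * (c - 3/4) \<le> left_cost a b c \<and>
    (left_cost a b c = half_error + gap\<^sup>2 * (c - 3/4) \<longrightarrow> a = second / 3 \<and> b = second \<and> c = 3/4)"
proof -
  consider "b + c \<le> 1" | "a + b \<le> 1" "1 \<le> b + c" | "1 \<le> a + b" using assms by linarith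
  then show ?thesis
  proof cases
    case 1
    have "(sqdist {a, b, c} has_integral (c - c)^3 / 3 - (1/2 - c)^3 / 3) {1/2..c}"
      using 1 assms by (intro has_integral_square sqdist_three_cells) auto
    then have "integral {1/2..c} (sqdist {a, b, c}) = (c - 1/2)^3 / 3"
      by (intro integral_unique, elim has_integral_eq_rhs) (simp add: power3_eq_cube field_simps)
    then have "half_error + gap\<^sup>2 * (c - 3/4) < left_cost a b c"
      using tangent_bound_edge_in_third_cell[of a b c] assms
      by (simp add: left_cost_def integral_three_cells add_divide_distrib)
    then show ?thesis by simp
  next
    case 2
    then show ?thesis
      using tangent_bound_edge_in_second_cell[of a b c] assms
      by (simp only: left_cost_edge_in_second_cell) auto
  next
    case 3
    have "integral {b..c} (sqdist {a, b, c}) = (c - b)^3 / 12 - (b - b)^3 / 3"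
      using assms by (intro integral_unique has_integral_last_two_cells) auto
    moreover have "integral {b..c} (sqdist {a, b, c}) \<le> integral {1/2..c} (sqdist {a, b, c})"
      using 3 assms by (intro integral_subset_le integrable_sqdist) (auto intro: sqdist_nonneg)
    ultimately have "half_error + gap\<^sup>2 * (c - 3/4) < left_cost a b c"
      using tangent_bound_edge_in_first_cell[of a b c] 3 assms
      by (simp add: left_cost_def integral_three_cells add_divide_distrib)
    then show ?thesis by simp
  qed
qed

lemma clip_below_nearer:
  fixes a p x :: real
  assumes "p \<le> x"
  shows "(x - max a p)\<^sup>2 \<le> (x - a)\<^sup>2"
  using assms by (auto simp: max_def intro: nearer_right)

text \<open>Points to the left of the support are moved to \<open>0\<close>, which does not increase the cost. If
  equality holds, it holds for the moved points as well, so these are the optimal ones; as they are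
  positive, nothing was moved.\<close>

lemma left_cost_bound:
  assumes "a \<le> b" "b \<le> c" "1/2 \<le> c" "c \<le> 1"
  shows "half_error + gap\<^sup>2 * (c - 3/4) \<le> left_cost a b c"
    and "left_cost a b c = half_error + gap\<^sup>2 * (c - 3/4) \<Longrightarrow> a = second / 3 \<and> b = second \<and> c = 3/4"
proof -
  let ?a = "max a 0" and ?b = "max b 0"
  have "sqdist {?a, ?b, c} x \<le> sqdist {a, b, c} x" if "0 \<le> x" for x
    using clip_below_nearer[OF that, of a] clip_below_nearer[OF that, of b]
    by (intro sqdist_dominated) auto
  then have "left_cost ?a ?b c \<le> left_cost a b c"
    unfolding left_cost_def by (intro divide_right_mono add_mono integral_le integrable_sqdist) auto
  moreover note left_cost_bound_nonneg[of ?a ?b c]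
  ultimately show "half_error + gap\<^sup>2 * (c - 3/4) \<le> left_cost a b c"
    and "left_cost a b c = half_error + gap\<^sup>2 * (c - 3/4) \<Longrightarrow> a = second / 3 \<and> b = second \<and> c = 3/4"
    using assms numeric_bounds by (auto simp: max_def split: if_splits)
qed

section \<open>Both sides together\<close>

text \<open>The expectation under the mixture, written so that only integrals of continuous functions over
  intervals occur.\<close>

definition mix_integral :: "(real \<Rightarrow> real) \<Rightarrow> real" where
  "mix_integral g = (integral {0..3/2} g + integral {1/2..1} g) / 2"

lemma mix_integral_reflect: "mix_integral (sqdist ((\<lambda>a. 3/2 - a) ` \<alpha>)) = mix_integral (sqdist \<alpha>)"
proof -
  have "sqdist ((\<lambda>a. 3/2 - a) ` \<alpha>) = (\<lambda>x. sqdist \<alpha> (3/2 - x))"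
    using sqdist_reflect[of "3/2" \<alpha> "3/2 - x" for x] by (auto simp: fun_eq_iff)
  then show ?thesis unfolding mix_integral_def by (simp add: integral_reflect)
qed

lemma mix_integral_split:
  assumes "c1 \<le> c2" "c2 \<le> c3" "c3 \<le> c4" "c4 \<le> c5" "1/2 \<le> c3" "c3 \<le> 1"
  shows "mix_integral (sqdist {c1, c2, c3, c4, c5}) =
    left_cost c1 c2 c3 + left_cost (3/2 - c5) (3/2 - c4) (3/2 - c3)"
proof -
  let ?g = "sqdist {c1, c2, c3, c4, c5}"
  have lo: "?g x = sqdist {c1, c2, c3} x" if "x \<le> c3" for x
    using nearer_left[of c3 c4 x] nearer_left[of c3 c5 x] assms that
    by (intro antisym sqdist_dominated) auto
  have hi: "?g x = sqdist {3/2 - c5, 3/2 - c4, 3/2 - c3} (3/2 - x)" if "c3 \<le> x" for x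
  proof -
    have "?g x = sqdist {c5, c4, c3} x"
      using nearer_right[of c1 c3 x] nearer_right[of c2 c3 x] assms that
      by (intro antisym sqdist_dominated) auto
    then show ?thesis using sqdist_reflect[of "3/2" "{c5, c4, c3}" x] by simp
  qed
  have split: "integral {p..q} ?g = integral {p..c3} (sqdist {c1, c2, c3})
      + integral {3/2 - q..3/2 - c3} (sqdist {3/2 - c5, 3/2 - c4, 3/2 - c3})"
    if "p \<le> c3" "c3 \<le> q" for p q
  proof -
    have "integral {p..q} ?g = integral {p..c3} ?g + integral {c3..q} ?g"
      using that by (intro Henstock_Kurzweil_Integration.integral_combine[symmetric] integrable_sqdist) auto
    also have "integral {p..c3} ?g = integral {p..c3} (sqdist {c1, c2, c3})"
      by (intro integral_cong lo) simp
    also have "integral {c3..q} ?g =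
        integral {c3..q} (\<lambda>x. sqdist {3/2 - c5, 3/2 - c4, 3/2 - c3} (3/2 - x))"
      by (intro integral_cong hi) simp
    also have "\<dots> = integral {3/2 - q..3/2 - c3} (sqdist {3/2 - c5, 3/2 - c4, 3/2 - c3})"
      by (rule integral_reflect)
    finally show ?thesis .
  qed
  show ?thesis
    using assms split[of 0 "3/2"] split[of "1/2" 1]
    by (simp add: mix_integral_def left_cost_def add_divide_distrib)
qed

lemma mix_integral_bound_third_point_central:
  assumes "c1 \<le> c2" "c2 \<le> c3" "c3 \<le> c4" "c4 \<le> c5" "1/2 \<le> c3" "c3 \<le> 1"
  defines "V \<equiv> mix_integral (sqdist {c1, c2, c3, c4, c5})"
  shows "2 * half_error \<le> V"
    and "V = 2 * half_error \<Longrightarrow>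
      c1 = second / 3 \<and> c2 = second \<and> c3 = 3/4 \<and> c4 = 3/2 - second \<and> c5 = 3/2 - second / 3"
proof -
  have V: "V = left_cost c1 c2 c3 + left_cost (3/2 - c5) (3/2 - c4) (3/2 - c3)"
    unfolding V_def using assms by (intro mix_integral_split)
  \<comment> \<open>The reflected third point \<open>3/2 - c3\<close> is as far from \<open>3/4\<close> as \<open>c3\<close>, on the other side.\<close>
  have slopes: "gap\<^sup>2 * (c3 - 3/4) + gap\<^sup>2 * (3/2 - c3 - 3/4) = 0" by (simp add: algebra_simps)
  note L = left_cost_bound[of c1 c2 c3] and R = left_cost_bound[of "3/2 - c5" "3/2 - c4" "3/2 - c3"]
  show "2 * half_error \<le> V" using V L(1) R(1) slopes assms by simp
  show "c1 = second / 3 \<and> c2 = second \<and> c3 = 3/4 \<and> c4 = 3/2 - second \<and> c5 = 3/2 - second / 3"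
    if "V = 2 * half_error"
  proof -
    have "left_cost c1 c2 c3 = half_error + gap\<^sup>2 * (c3 - 3/4)"
      "left_cost (3/2 - c5) (3/2 - c4) (3/2 - c3) = half_error + gap\<^sup>2 * (3/2 - c3 - 3/4)"
      using that V L(1) R(1) slopes assms by auto
    then show ?thesis using L(2) R(2) assms by auto
  qed
qed

text \<open>The points right of \<open>1\<close> are moved to \<open>1\<close> and the mass right of \<open>1\<close> is discarded; the tangent bound at \<open>c = 1\<close>
  then applies.\<close>

lemma mix_integral_bound_third_point_right:
  assumes "c1 \<le> c2" "c2 \<le> c3" "c3 \<le> c4" "c4 \<le> c5" "1 \<le> c3"
  shows "2 * half_error < mix_integral (sqdist {c1, c2, c3, c4, c5})"
proof -
  let ?g = "sqdist {c1, c2, c3, c4, c5}" and ?h = "sqdist {min c1 1, min c2 1, 1}"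
  have clip: "(x - min a 1)\<^sup>2 \<le> (x - a)\<^sup>2" if "x \<le> 1" for a x :: real
    using that by (auto simp: min_def intro: nearer_left)
  have le: "?h x \<le> ?g x" if "x \<le> 1" for x
    using clip[OF that, of c1] clip[OF that, of c2] clip[OF that, of c3] clip[OF that, of c4]
      clip[OF that, of c5] assms
    by (intro sqdist_dominated) auto
  have "half_error + gap\<^sup>2 * (1 - 3/4) \<le> left_cost (min c1 1) (min c2 1) 1"
    using assms by (intro left_cost_bound) auto
  also have "\<dots> \<le> (integral {0..1} ?g + integral {1/2..1} ?g) / 2"
    unfolding left_cost_def by (intro divide_right_mono add_mono integral_le integrable_sqdist le) auto
  also have "\<dots> \<le> mix_integral ?g"
    unfolding mix_integral_def
    by (intro divide_right_mono add_mono integral_subset_le integrable_sqdist order_refl)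
       (auto intro: sqdist_nonneg)
  finally show ?thesis using numeric_bounds by simp
qed

lemma mix_integral_bound:
  assumes "c1 \<le> c2" "c2 \<le> c3" "c3 \<le> c4" "c4 \<le> c5"
  defines "V \<equiv> mix_integral (sqdist {c1, c2, c3, c4, c5})"
  shows "2 * half_error \<le> V"
    and "V = 2 * half_error \<Longrightarrow>
      c1 = second / 3 \<and> c2 = second \<and> c3 = 3/4 \<and> c4 = 3/2 - second \<and> c5 = 3/2 - second / 3"
proof -
  have V: "V = mix_integral (sqdist {3/2 - c5, 3/2 - c4, 3/2 - c3, 3/2 - c2, 3/2 - c1})"
    using mix_integral_reflect[of "{c1, c2, c3, c4, c5}"] unfolding V_def
    by (simp add: insert_commute)
  have far: "2 * half_error < V" if "c3 \<le> 1/2 \<or> 1 \<le> c3"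
    using that
  proof
    assume "c3 \<le> 1/2"
    then show ?thesis unfolding V using assms by (intro mix_integral_bound_third_point_right) auto
  next
    assume "1 \<le> c3"
    then show ?thesis unfolding V_def using assms by (intro mix_integral_bound_third_point_right) auto
  qed
  show "2 * half_error \<le> V"
    and "V = 2 * half_error \<Longrightarrow>
      c1 = second / 3 \<and> c2 = second \<and> c3 = 3/4 \<and> c4 = 3/2 - second \<and> c5 = 3/2 - second / 3"
    using far mix_integral_bound_third_point_central[of c1 c2 c3 c4 c5] assms(1-4) unfolding V_def by force+
qed

definition optimum :: "real set" where
  "optimum = {second / 3, second, 3/4, 3/2 - second, 3/2 - second / 3}"

lemma mix_integral_optimum: "mix_integral (sqdist optimum) = 2 * half_error"
  unfolding optimum_def using numeric_bounds
  by (subst mix_integral_split) (auto simp: left_cost_optimum)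

section \<open>Optimal sets of five means\<close>

text \<open>A set with fewer than five elements is enumerated with its largest element repeated.\<close>

lemma sorted_enumeration_five:
  fixes \<alpha> :: "real set"
  assumes "1 \<le> card \<alpha>" "card \<alpha> \<le> 5"
  obtains c1 c2 c3 c4 c5 where "c1 \<le> c2" "c2 \<le> c3" "c3 \<le> c4" "c4 \<le> c5" "\<alpha> = {c1, c2, c3, c4, c5}"
proof -
  define xs where "xs = sorted_list_of_set \<alpha>"
  have fin: "finite \<alpha>" using assms(1) by (intro card_ge_0_finite) simp
  then have xs: "sorted xs" "set xs = \<alpha>" "length xs = card \<alpha>" by (simp_all add: xs_def)
  define c where "c i = xs ! min i (length xs - 1)" for i
  have mono: "c i \<le> c (Suc i)" for i
    unfolding c_def using xs assms by (intro sorted_nth_mono) auto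
  have "\<alpha> = c ` {..<5}"
  proof
    show "\<alpha> \<subseteq> c ` {..<5}"
    proof
      fix x assume "x \<in> \<alpha>"
      then obtain i where "i < length xs" "x = xs ! i" using xs by (metis in_set_conv_nth)
      then show "x \<in> c ` {..<5}" using xs assms by (intro image_eqI[of _ _ i]) (auto simp: c_def)
    qed
    show "c ` {..<5} \<subseteq> \<alpha>"
      using xs assms by (auto simp: c_def simp flip: xs(2) intro!: nth_mem)
  qed
  also have "\<dots> = {c 0, c 1, c 2, c 3, c 4}" by (auto simp: eval_nat_numeral lessThan_Suc)
  finally show thesis
    using mono[of 0] mono[of 1] mono[of 2] mono[of 3] by (intro that) (simp_all add: eval_nat_numeral)
qed

lemma distortion_mixP:
  assumes "finite \<alpha>" "\<alpha> \<noteq> {}"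
  shows "distortion mixP \<alpha> = ennreal (mix_integral (sqdist \<alpha>))"
proof -
  let ?g = "sqdist \<alpha>"
  have [measurable]: "?g \<in> borel_measurable borel"
    using assms by (intro borel_measurable_continuous_onI continuous_on_sqdist)
  have nonneg: "0 \<le> ?g x" for x using assms by (rule sqdist_nonneg)
  have part: "(\<integral>\<^sup>+x. ennreal (indicat_real {p..q} x * ?g x / 2) \<partial>lborel)
      = ennreal (integral {p..q} ?g / 2)" for p q
    using nonneg assms
    unfolding times_divide_eq_right[symmetric]
    by (intro nn_integral_has_integral_lebesgue has_integral_divide integrable_integral
        integrable_sqdist) auto
  have "distortion mixP \<alpha> = (\<integral>\<^sup>+x. ennreal (if 1/2 \<le> x \<and> x \<le> 1 then 1
          else if 0 \<le> x \<and> x \<le> 3/2 then 1/2 else 0) * ennreal (?g x) \<partial>lborel)"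
    unfolding distortion_def mixP_eq_density sqdist_def[symmetric]
    by (subst nn_integral_density) auto
  also have "\<dots> = (\<integral>\<^sup>+x. ennreal (indicat_real {0..3/2} x * ?g x / 2)
      + ennreal (indicat_real {1/2..1} x * ?g x / 2) \<partial>lborel)"
  proof (intro nn_integral_cong)
    fix x :: real
    show "ennreal (if 1/2 \<le> x \<and> x \<le> 1 then 1 else if 0 \<le> x \<and> x \<le> 3/2 then 1/2 else 0) * ennreal (?g x)
      = ennreal (indicat_real {0..3/2} x * ?g x / 2) + ennreal (indicat_real {1/2..1} x * ?g x / 2)"
      using nonneg[of x] by (auto simp: indicator_def simp flip: ennreal_plus ennreal_mult)
  qed
  also have "\<dots> = ennreal (integral {0..3/2} ?g / 2) + ennreal (integral {1/2..1} ?g / 2)"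
    by (subst nn_integral_add) (auto simp: part)
  also have "\<dots> = ennreal (mix_integral ?g)"
    using nonneg assms unfolding mix_integral_def add_divide_distrib
    by (intro ennreal_plus[symmetric]) (auto intro!: integral_nonneg integrable_sqdist)
  finally show ?thesis .
qed

lemma round_decI: "\<bar>x * 10 ^ d - of_int n\<bar> < 1/2 \<Longrightarrow> round_dec d x = of_int n / 10 ^ d"
  by (simp add: round_dec_def round_unique')

theorem proposition3p5:
  shows "\<exists>a1 a2 a4 a5 :: real.
           {\<alpha>. optimal_means mixP 5 \<alpha>} = {{a1, a2, 3/4, a4, a5}} \<and>
           round_dec 6 a1 = 0.169821 \<and>
           round_dec 6 a2 = 0.509464 \<and>
           round_dec 6 a4 = 0.990536 \<and>
           round_dec 5 a5 = 1.33018 \<and>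
           round_dec 8 (enn2real (quantization_error mixP 5)) = 0.00721728"
proof -
  have half_error_pos: "0 \<le> half_error"
    using sqrt5_bounds by (simp add: half_error_def)
  have lower: "ennreal (2 * half_error) \<le> distortion mixP \<alpha>
      \<and> (distortion mixP \<alpha> = ennreal (2 * half_error) \<longrightarrow> \<alpha> = optimum)"
    if card_le: "1 \<le> card \<alpha>" "card \<alpha> \<le> 5" for \<alpha>
  proof -
    obtain c1 c2 c3 c4 c5 where c: "c1 \<le> c2" "c2 \<le> c3" "c3 \<le> c4" "c4 \<le> c5" "\<alpha> = {c1, c2, c3, c4, c5}"
      using sorted_enumeration_five[OF card_le] by blast
    have "distortion mixP \<alpha> = ennreal (mix_integral (sqdist {c1, c2, c3, c4, c5}))"
      unfolding c(5) by (rule distortion_mixP) auto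
    then show ?thesis
      using mix_integral_bound[OF c(1-4)] half_error_pos c(5)
      by (auto simp: optimum_def intro!: ennreal_leI)
  qed
  have card: "1 \<le> card optimum" "card optimum \<le> 5"
    unfolding optimum_def by (simp_all add: card_insert_if card_gt_0_iff Suc_le_eq)
  have dist_optimum: "distortion mixP optimum = ennreal (2 * half_error)"
    unfolding mix_integral_optimum[symmetric] by (intro distortion_mixP) (auto simp: optimum_def)
  have V: "quantization_error mixP 5 = ennreal (2 * half_error)"
    unfolding quantization_error_def
  proof (rule antisym)
    show "(INF \<alpha>\<in>{\<alpha>. 1 \<le> card \<alpha> \<and> card \<alpha> \<le> 5}. distortion mixP \<alpha>) \<le> ennreal (2 * half_error)"
      using card by (intro INF_lower2[of optimum]) (auto simp: dist_optimum)
  qed (intro INF_greatest, use lower in auto)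
  have "{\<alpha>. optimal_means mixP 5 \<alpha>} = {optimum}"
    using lower card dist_optimum unfolding optimal_means_def V by auto
  moreover have "round_dec 6 (second / 3) = 0.169821" "round_dec 6 second = 0.509464"
      "round_dec 6 (3/2 - second) = 0.990536" "round_dec 5 (3/2 - second / 3) = 1.33018"
      "round_dec 8 (2 * half_error) = 0.00721728"
    using sqrt5_bounds round_decI[of "second / 3" 6 169821] round_decI[of second 6 509464]
      round_decI[of "3/2 - second" 6 990536] round_decI[of "3/2 - second / 3" 5 133018]
      round_decI[of "2 * half_error" 8 721728]
    by (simp_all add: second_def half_error_def abs_less_iff)
  ultimately show ?thesis
    using half_error_pos unfolding V optimum_def by auto
qed

end
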